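(* Let $N,p,q$ be integers with $1\le q\le p<N$, and let $A$ be a cyclically contiguous $p\times q$ submatrix of the $N\times N$ discrete Fourier matrix $F$. Then $$\operatorname{cond}(A)\;\ge\;\frac{I_0\bigl(\frac{\pi}{2}(1-p/N)\,q\bigr)-1}{2\bigl(\sqrt{N/p}+6q\bigr)},$$ where $I_0$ is the modified Bessel function of the first kind of order zero.
   Context: The $N\times N$ discrete Fourier matrix is $F=(F_{jk})$, $F_{jk}=e^{2\pi i jk/N}$, with integer row and column indices $-N/2\le j,k<N/2$; index sets are regarded as $N$-periodic (i.e. as residues mod $N$). A cyclically contiguous $p\times q$ submatrix of $F$ is one whose row index set consists of $p$ cyclically consecutive residues mod $N$ and whose column index set consists of $q$ cyclically consecutive residues mod $N$. For a $p\times q$ matrix $A$ with singular values $\sigma_1\ge\sigma_2\ge\dots\ge\sigma_{\min(p,q)}=:\sigma_{\min}(A)$, the condition number is $\operatorname{cond}(A)=\sigma_1(A)/\sigma_{\min}(A)$. The function $I_0$ is $I_0(z)=\sum_{k\ge0}\frac{(z/2)^{2k}}{(k!)^2}$. *)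

theory Defs
  imports
    Complex_Main
    "Jordan_Normal_Form.Char_Poly"
    "Jordan_Normal_Form.Schur_Decomposition"
    "Jordan_Normal_Form.DL_Submatrix"
begin

text \<open>
  Matrix positions run over \<open>0, \<dots>, N - 1\<close>, whereas rows and columns of the Fourier matrix are
  labelled by the integers \<open>j\<close> with \<open>- N/2 \<le> j < N/2\<close>, in increasing order.
\<close>

definition dft_index :: "nat \<Rightarrow> nat \<Rightarrow> int" where
  "dft_index N a = int a - int (N div 2)"

lemma bij_betw_dft_index:
  "bij_betw (dft_index N) {..<N} {j. - (real N / 2) \<le> of_int j \<and> of_int j < real N / 2}"
proof (rule bij_betwI[where g = "\<lambda>j. nat (j + int (N div 2))"])
  show "dft_index N \<in> {..<N} \<rightarrow> {j. - (real N / 2) \<le> of_int j \<and> of_int j < real N / 2}"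
  proof
    fix a assume "a \<in> {..<N}"
    then have "- int N \<le> 2 * dft_index N a \<and> 2 * dft_index N a < int N"
      unfolding dft_index_def by auto
    then show "dft_index N a \<in> {j. - (real N / 2) \<le> of_int j \<and> of_int j < real N / 2}"
      by auto
  qed
  show "(\<lambda>j. nat (j + int (N div 2))) \<in> {j. - (real N / 2) \<le> of_int j \<and> of_int j < real N / 2} \<rightarrow> {..<N}"
  proof
    fix j :: int assume "j \<in> {j. - (real N / 2) \<le> of_int j \<and> of_int j < real N / 2}"
    then have "- int N \<le> 2 * j \<and> 2 * j < int N" by auto
    then show "nat (j + int (N div 2)) \<in> {..<N}" by auto
  qed
  show "nat (dft_index N a + int (N div 2)) = a" for a
    by (simp add: dft_index_def)
  show "dft_index N (nat (j + int (N div 2))) = j"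
    if "j \<in> {j. - (real N / 2) \<le> of_int j \<and> of_int j < real N / 2}" for j
  proof -
    have "- int N \<le> 2 * j" using that by auto
    then show ?thesis unfolding dft_index_def by auto
  qed
qed

definition dft_mat :: "nat \<Rightarrow> complex mat" where
  "dft_mat N = mat N N (\<lambda>(a, b).
     exp (2 * of_real pi * \<i> * of_int (dft_index N a) * of_int (dft_index N b) / of_nat N))"

text \<open>
  \<^term>\<open>dft_index N\<close> is a shift, so cyclically consecutive positions are the same thing as cyclically
  consecutive residues modulo \<open>N\<close>.
\<close>

definition cyclic_run :: "nat \<Rightarrow> nat \<Rightarrow> nat set \<Rightarrow> bool" where
  "cyclic_run N p I \<longleftrightarrow> (\<exists>s. I = (\<lambda>i. (s + i) mod N) ` {..<p})"

text \<open>
  The constant \<^const>\<open>submatrix\<close> lists the selected rows and columns in increasing order of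
  position, also for index sets that wrap around; the order does not affect the singular values.
\<close>

definition cyclically_contiguous_submatrix :: "nat \<Rightarrow> nat \<Rightarrow> 'a mat \<Rightarrow> 'a mat \<Rightarrow> bool" where
  "cyclically_contiguous_submatrix p q F A \<longleftrightarrow>
     (\<exists>I J. cyclic_run (dim_row F) p I \<and> cyclic_run (dim_col F) q J \<and> A = submatrix F I J)"

text \<open>
  The \<open>min m n\<close> singular values of an \<open>m \<times> n\<close> matrix in decreasing order, with multiplicity: the
  square roots of the eigenvalues of the smaller one of its two Gram matrices. These eigenvalues
  are real and nonnegative, so that taking real parts loses nothing.
\<close>

definition gram_mat :: "complex mat \<Rightarrow> complex mat" where
  "gram_mat A = (if dim_col A \<le> dim_row A then mat_adjoint A * A else A * mat_adjoint A)"

definition singular_values :: "complex mat \<Rightarrow> real list" where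
  "singular_values A =
     rev (sorted_list_of_multiset
       (image_mset (\<lambda>x. sqrt (Re x)) (proots (char_poly (gram_mat A)))))"

text \<open>
  If the smallest singular value is \<open>0\<close>, this ratio is \<open>0\<close> rather than infinite; a positive lower
  bound on it therefore includes that the smallest singular value does not vanish.
\<close>

definition condition_number :: "complex mat \<Rightarrow> real" where
  "condition_number A = hd (singular_values A) / last (singular_values A)"

definition bessel_I0 :: "real \<Rightarrow> real" where
  "bessel_I0 z = (\<Sum>k. (z / 2) ^ (2 * k) / (fact k)\<^sup>2)"

end

theory Submission
  imports Defs "HOL-Analysis.Convex"
begin

text \<open>
  A vector of length \<open>q\<close> is a polynomial \<open>P\<close> of degree less than \<open>q\<close>, and \<open>A\<close> evaluates it, up to
  unimodular factors, at \<open>p\<close> consecutive \<open>N\<close>-th roots of unity. Instead of a sampled Kaiser-Bessel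
  window we take as test vector the Chebyshev polynomial of the arc carrying these nodes: with
  \<open>x = \<pi>/2 (1 - p/N)\<close> the arc is \<open>\<bar>sin (\<theta>/2)\<bar> \<le> cos x\<close>, and \<open>T\<^sub>n (sin (\<theta>/2) / cos x)\<close>, \<open>n = q - 1\<close>, is
  bounded by 1 there, while at the opposite point it is \<open>T\<^sub>n (1 / cos x) \<ge> cosh (n x)\<close> because
  \<open>cosh x * cos x \<le> 1\<close>. By Cauchy-Schwarz the test vector has norm at least \<open>cosh (n x) / sqrt q\<close>, its
  image has norm at most \<open>sqrt p\<close>, and the image of a unit vector has norm \<open>sqrt p\<close>, so the condition
  number is at least \<open>cosh ((q - 1) x) / sqrt q\<close>. Since \<open>I\<^sub>0 \<le> cosh\<close>, this exceeds the claimed bound.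
\<close>

subsection \<open>The Chebyshev polynomial of an arc\<close>

lemma cosh_times_cos_le_1:
  fixes x :: real
  assumes "0 \<le> x" "x \<le> pi"
  shows "cosh x * cos x \<le> 1"
proof -
  \<comment> \<open>This is the derivative of \<open>cosh y * cos y\<close>. It vanishes at 0 and
    has itself the nonpositive derivative \<open>- (2 * sinh z * sin z)\<close>, so monotonicity is
    applied twice.\<close>
  have deriv_nonpos: "sinh y * cos y - cosh y * sin y \<le> 0" if y: "0 \<le> y" "y \<le> pi" for y :: real
  proof -
    have "sinh y * cos y - cosh y * sin y \<le> sinh 0 * cos 0 - cosh 0 * sin (0::real)"
    proof (rule DERIV_nonpos_imp_nonincreasing[OF y(1)])
      fix z assume z: "0 \<le> z" "z \<le> y"
      have "((\<lambda>z. sinh z * cos z - cosh z * sin z) has_real_derivative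
              - (2 * sinh z * sin z)) (at z)"
        by (auto intro!: derivative_eq_intros simp: algebra_simps)
      moreover have "sinh z * sin z \<ge> 0"
        using z y by (auto intro!: mult_nonneg_nonneg sin_ge_zero)
      ultimately show "\<exists>d. ((\<lambda>z. sinh z * cos z - cosh z * sin z) has_real_derivative d) (at z) \<and> d \<le> 0"
        by (intro exI[of _ "- (2 * sinh z * sin z)"]) (simp add: mult.assoc)
    qed
    then show ?thesis by simp
  qed
  have "cosh x * cos x \<le> cosh 0 * cos (0::real)"
  proof (rule DERIV_nonpos_imp_nonincreasing[OF assms(1)])
    fix y assume y: "0 \<le> y" "y \<le> x"
    have "((\<lambda>y. cosh y * cos y) has_real_derivative (sinh y * cos y - cosh y * sin y)) (at y)"
      by (auto intro!: derivative_eq_intros simp: algebra_simps)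
    then show "\<exists>d. ((\<lambda>y. cosh y * cos y) has_real_derivative d) (at y) \<and> d \<le> 0"
      using deriv_nonpos[of y] y assms(2) by fastforce
  qed
  then show ?thesis by simp
qed

text \<open>The comparison is termwise: (2k)! is (k!)^2 times the central binomial coefficient,
  which is at most 4^k.\<close>

lemma bessel_I0_le_cosh:
  assumes "0 \<le> z"
  shows "bessel_I0 z \<le> cosh z"
proof -
  define f where "f = (\<lambda>n. if even n then z ^ n / fact n else 0)"
  define g where "g = (\<lambda>k. (z / 2) ^ (2 * k) / (fact k)\<^sup>2)"
  have f_sums: "f sums cosh z"
    using cosh_converges[of z] by (simp add: f_def divide_inverse mult.commute cong: if_cong)
  have f_nonneg: "0 \<le> f n" and g_nonneg: "0 \<le> g n" for n
    using assms by (auto simp: f_def g_def)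
  have g_le: "g k \<le> f (2 * k)" for k
  proof -
    have "fact k * fact k * ((2 * k) choose k) = (fact (2 * k) :: nat)"
      using binomial_fact_lemma[of k "2 * k"] by simp
    moreover have "(2 * k) choose k \<le> 2 ^ (2 * k)"
      by (rule binomial_le_pow2)
    ultimately have "fact (2 * k) \<le> fact k * fact k * (2 ^ (2 * k) :: nat)"
      by (metis mult_le_mono2)
    then have "real (fact (2 * k)) \<le> real (fact k * fact k * 2 ^ (2 * k))"
      by (rule of_nat_mono)
    then have le: "(fact (2 * k) :: real) \<le> 2 ^ (2 * k) * (fact k)\<^sup>2"
      by (simp add: power2_eq_square mult_ac)
    have "g k = z ^ (2 * k) / (2 ^ (2 * k) * (fact k)\<^sup>2)"
      by (simp add: g_def power_divide)
    also have "\<dots> \<le> f (2 * k)"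
      using divide_left_mono[OF le] assms by (simp add: f_def)
    finally show ?thesis .
  qed
  \<comment> \<open>Bounded partial sums of nonnegative terms yield the summability of the Bessel
    series as well as the bound on its sum.\<close>
  have partial: "sum g {..<n} \<le> cosh z" for n
  proof -
    have "sum g {..<n} \<le> (\<Sum>k<n. f (2 * k))"
      by (intro sum_mono g_le)
    also have "\<dots> = sum f ((*) 2 ` {..<n})"
      by (subst sum.reindex) (auto simp: inj_on_def)
    also have "\<dots> \<le> suminf f"
      by (intro sum_le_suminf) (use f_sums f_nonneg in \<open>auto simp: sums_iff\<close>)
    finally show ?thesis using f_sums by (simp add: sums_iff)
  qed
  then have "summable g"
    by (intro summableI_nonneg_bounded g_nonneg)
  then have "suminf g \<le> cosh z"
    by (rule suminf_le_const) (rule partial)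
  then show ?thesis by (simp add: bessel_I0_def g_def)
qed

text \<open>
  On the unit circle, \<open>e\<^bsup>-in\<theta>/2\<^esup>\<close> times the value at \<open>e\<^bsup>i\<theta>\<^esup>\<close> is the Chebyshev polynomial \<open>T\<^sub>n\<close>
  at \<open>2 i a sin (\<theta>/2)\<close>; the recursion is the one for \<open>T\<^sub>n\<close>, multiplied through by that phase.
\<close>

fun arc_chebyshev :: "complex \<Rightarrow> nat \<Rightarrow> complex poly" where
  "arc_chebyshev a 0 = 1"
| "arc_chebyshev a (Suc 0) = smult a [:-1, 1:]"
| "arc_chebyshev a (Suc (Suc n)) =
     smult (2 * a) [:-1, 1:] * arc_chebyshev a (Suc n) - [:0, 1:] * arc_chebyshev a n"

lemma degree_arc_chebyshev_le: "degree (arc_chebyshev a n) \<le> n"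
proof (induction a n rule: arc_chebyshev.induct)
  case (3 a n)
  have "degree (smult (2 * a) [:-1, 1:]) \<le> 1" by simp
  then have "degree (smult (2 * a) [:-1, 1:] * arc_chebyshev a (Suc n)) \<le> Suc (Suc n)"
    using degree_mult_le[of "smult (2 * a) [:-1, 1:]" "arc_chebyshev a (Suc n)"] 3 by linarith
  moreover have "degree ([:0, 1:] * arc_chebyshev a n) \<le> Suc (Suc n)"
    using degree_mult_le[of "[:0, 1:]" "arc_chebyshev a n"] 3 by simp
  ultimately show ?case
    unfolding arc_chebyshev.simps by (rule degree_diff_le)
qed auto

text \<open>\<open>(w ^ n + inverse w ^ n) / 2\<close> is T_n at \<open>(w + inverse w) / 2\<close>.
  The parameter \<open>w\<close> serves both regimes: unimodular for arguments in [-1, 1], real for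
  arguments beyond 1. The square root \<open>r\<close> of the evaluation point carries the
  phase.\<close>

lemma poly_arc_chebyshev:
  assumes "a * (r\<^sup>2 - 1) = r * ((w + inverse w) / 2)" and "w \<noteq> 0"
  shows "poly (arc_chebyshev a n) (r\<^sup>2) = r ^ n * ((w ^ n + inverse w ^ n) / 2)"
proof -
  define T where "T k = (w ^ k + inverse w ^ k) / 2" for k :: nat
  have T_rec: "T (Suc (Suc k)) = 2 * T 1 * T (Suc k) - T k" for k
    using \<open>w \<noteq> 0\<close> by (simp add: T_def field_simps)
  have T_1: "a * (r\<^sup>2 - 1) = r * T 1"
    using assms(1) by (simp add: T_def)
  have "poly (arc_chebyshev a n) (r\<^sup>2) = r ^ n * T n"
  \<comment> \<open>Only \<open>n\<close> varies in the induction; the slot of the rule for the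
    parameter \<open>a\<close> gets a dummy value.\<close>
  proof (induction n rule: arc_chebyshev.induct[of _ undefined])
    case 1
    then show ?case by (simp add: T_def)
  next
    case 2
    then show ?case using T_1 by (simp add: algebra_simps)
  next
    case (3 _ n)
    have "poly (arc_chebyshev a (Suc (Suc n))) (r\<^sup>2) =
       2 * (a * (r\<^sup>2 - 1)) * poly (arc_chebyshev a (Suc n)) (r\<^sup>2) - r\<^sup>2 * poly (arc_chebyshev a n) (r\<^sup>2)"
      by (simp add: algebra_simps)
    also have "\<dots> = r ^ Suc (Suc n) * T (Suc (Suc n))"
      unfolding 3 T_1 T_rec by (simp add: algebra_simps power2_eq_square)
    finally show ?case .
  qed
  then show ?thesis by (simp add: T_def)
qed

text \<open>On the arc the Chebyshev argument \<open>sin (\<theta> / 2) / s\<close> lies in [-1, 1]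
  and is the cosine of a real angle. So \<open>w\<close> is unimodular, and the mean of
  \<open>w ^ n\<close> and its inverse has modulus at most 1.\<close>

lemma norm_arc_chebyshev_arc:
  assumes s: "0 < s" and "\<bar>sin (\<theta> / 2)\<bar> \<le> s"
  shows "cmod (poly (arc_chebyshev (1 / (2 * \<i> * of_real s)) n) (cis \<theta>)) \<le> 1"
proof -
  define w where "w = cis (arccos (sin (\<theta> / 2) / s))"
  define r where "r = cis (\<theta> / 2)"
  have norms: "cmod r = 1" "cmod w = 1" by (simp_all add: r_def w_def)
  then have "w \<noteq> 0" by auto
  have r2: "r\<^sup>2 = cis \<theta>" by (simp add: r_def power2_eq_square cis_mult)
  have "cos (arccos (sin (\<theta> / 2) / s)) = sin (\<theta> / 2) / s"
    using assms by (intro cos_arccos) (auto simp: field_simps abs_le_iff)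
  then have w_sum: "(w + inverse w) / 2 = of_real (sin (\<theta> / 2) / s)"
    by (simp add: w_def complex_eq_iff cis_inverse)
  \<comment> \<open>Multiplying by \<open>r\<close> gives \<open>cis \<theta> - 1\<close> as
    \<open>r\<close> times \<open>2 * \<i> * sin (\<theta> / 2)\<close>, which is why the parameter
    is \<open>1 / (2 * \<i> * s)\<close>.\<close>
  have "r - cnj r = 2 * \<i> * of_real (sin (\<theta> / 2))" "r * cnj r = 1"
    by (simp_all add: r_def complex_eq_iff complex_mult_cnj cis_cnj cis_mult)
  then have "r\<^sup>2 - 1 = r * (2 * \<i> * of_real (sin (\<theta> / 2)))"
    by (metis power2_eq_square right_diff_distrib)
  then have "1 / (2 * \<i> * of_real s) * (r\<^sup>2 - 1) = r * ((w + inverse w) / 2)"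
    unfolding w_sum using s by simp
  from poly_arc_chebyshev[OF this \<open>w \<noteq> 0\<close>, of n]
  have "poly (arc_chebyshev (1 / (2 * \<i> * of_real s)) n) (cis \<theta>) =
      r ^ n * ((w ^ n + inverse w ^ n) / 2)"
    by (simp only: r2)
  then have "cmod (poly (arc_chebyshev (1 / (2 * \<i> * of_real s)) n) (cis \<theta>)) =
      cmod (w ^ n + inverse w ^ n) / 2"
    using norms by (simp only: norm_mult norm_power norm_divide) simp
  also have "\<dots> \<le> (cmod (w ^ n) + cmod (inverse w ^ n)) / 2"
    by (intro divide_right_mono norm_triangle_ineq) simp
  also have "\<dots> = 1" using norms by (simp add: norm_power norm_inverse)
  finally show ?thesis .
qed

text \<open>The point opposite to the arc, where \<open>T\<^sub>n\<close> is evaluated at \<open>1 / cos x\<close>.\<close>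

lemma norm_arc_chebyshev_minus_1:
  assumes x: "0 \<le> x" "x < pi / 2"
  shows "cosh (real n * x) \<le>
    cmod (poly (arc_chebyshev (1 / (2 * \<i> * of_real (cos x))) n) (- 1))"
proof -
  define s where "s = cos x"
  have s: "0 < s" unfolding s_def using x by (intro cos_gt_zero_pi) auto
  \<comment> \<open>With \<open>cosh \<tau> = 1 / s\<close>, the value of T_n at
    \<open>1 / s\<close> is \<open>cosh (n * \<tau>)\<close>; the inequality
    \<open>cosh x * cos x \<le> 1\<close> then gives \<open>x \<le> \<tau>\<close>.\<close>
  define \<tau> where "\<tau> = arcosh (1 / s)"
  have "s \<le> 1" by (simp add: s_def)
  then have s1: "1 \<le> 1 / s" using s by (simp add: field_simps)
  have cosh_\<tau>: "cosh \<tau> = 1 / s" and \<tau>0: "0 \<le> \<tau>"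
    unfolding \<tau>_def using s1 by (auto simp: arcosh_nonneg_real)
  have "cosh x * s \<le> 1"
    unfolding s_def using cosh_times_cos_le_1[of x] x by simp
  then have "cosh x \<le> cosh \<tau>"
    using s by (simp add: cosh_\<tau> field_simps)
  then have le: "x \<le> \<tau>"
    using x \<tau>0 by (simp add: cosh_real_nonneg_le_iff)
  define w where "w = complex_of_real (exp \<tau>)"
  have w_power: "(w ^ k + inverse w ^ k) / 2 = of_real (cosh (real k * \<tau>))" for k
    by (simp add: w_def cosh_field_def exp_minus exp_of_nat_mult power_inverse)
  \<comment> \<open>The evaluation point -1 has the square root \<open>r = \<i>\<close>, that is,
    angle pi.\<close>
  have "1 / (2 * \<i> * of_real s) * (\<i>\<^sup>2 - 1) = \<i> * ((w + inverse w) / 2)"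
    using w_power[of 1] s by (simp add: cosh_\<tau> field_simps)
  from poly_arc_chebyshev[OF this, of n]
  have "poly (arc_chebyshev (1 / (2 * \<i> * of_real s)) n) (- 1) = \<i> ^ n * of_real (cosh (real n * \<tau>))"
    unfolding w_power by (simp add: w_def)
  then have "cmod (poly (arc_chebyshev (1 / (2 * \<i> * of_real s)) n) (- 1)) = cosh (real n * \<tau>)"
    by (simp add: norm_mult norm_power)
  also have "\<dots> \<ge> cosh (real n * x)"
    using x le \<tau>0 by (subst cosh_real_nonneg_le_iff) (auto intro: mult_left_mono)
  finally show ?thesis by (simp add: s_def)
qed

subsection \<open>Rayleigh quotients and singular values\<close>

definition vnorm2 :: "complex vec \<Rightarrow> real" where
  "vnorm2 v = (\<Sum>i<dim_vec v. (cmod (v $ i))\<^sup>2)"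

lemma cscalar_prod_self: "v \<bullet>c v = of_real (vnorm2 v)"
proof -
  have "complex_of_real (vnorm2 v) = (\<Sum>i<dim_vec v. v $ i * cnj (v $ i))"
    by (simp only: vnorm2_def of_real_sum complex_norm_square)
  then show ?thesis
    by (simp add: scalar_prod_def atLeast0LessThan)
qed

lemma vnorm2_nonneg [simp]: "0 \<le> vnorm2 v"
  by (simp add: vnorm2_def sum_nonneg)

lemma vnorm2_pos:
  assumes "v \<in> carrier_vec n" "v \<noteq> 0\<^sub>v n"
  shows "0 < vnorm2 v"
proof -
  obtain i where "i < n" "v $ i \<noteq> 0"
    using assms eq_vecI[of v "0\<^sub>v n"] by auto
  then show ?thesis
    unfolding vnorm2_def using assms by (intro sum_pos2[of _ i]) auto
qed

lemma cscalar_prod_commute: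
  fixes u w :: "complex vec"
  assumes "u \<in> carrier_vec n" "w \<in> carrier_vec n"
  shows "u \<bullet>c w = conjugate (w \<bullet>c u)"
  using assms by (simp add: scalar_prod_def mult.commute)

text \<open>AM-GM in each coordinate. This crude substitute for Cauchy-Schwarz suffices where the
  size of the resulting constant is immaterial.\<close>

lemma two_abs_Re_cscalar_prod_le:
  assumes "u \<in> carrier_vec n" "w \<in> carrier_vec n"
  shows "2 * \<bar>Re (u \<bullet>c w)\<bar> \<le> vnorm2 u + vnorm2 w"
proof -
  have term_le: "2 * \<bar>Re (u $ i * cnj (w $ i))\<bar> \<le> (cmod (u $ i))\<^sup>2 + (cmod (w $ i))\<^sup>2" for i
  proof -
    have "2 * \<bar>Re (u $ i * cnj (w $ i))\<bar> \<le> 2 * cmod (u $ i) * cmod (w $ i)"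
      using abs_Re_le_cmod[of "u $ i * cnj (w $ i)"] by (simp add: norm_mult)
    also have "\<dots> \<le> (cmod (u $ i))\<^sup>2 + (cmod (w $ i))\<^sup>2"
      by (rule sum_squares_bound)
    finally show ?thesis .
  qed
  have "Re (u \<bullet>c w) = (\<Sum>i<n. Re (u $ i * cnj (w $ i)))"
    using assms by (simp add: scalar_prod_def atLeast0LessThan)
  then have "2 * \<bar>Re (u \<bullet>c w)\<bar> \<le> (\<Sum>i<n. 2 * \<bar>Re (u $ i * cnj (w $ i))\<bar>)"
    using sum_abs[of "\<lambda>i. Re (u $ i * cnj (w $ i))" "{..<n}"] by (simp only: sum_distrib_left[symmetric])
  also have "\<dots> \<le> (\<Sum>i<n. (cmod (u $ i))\<^sup>2 + (cmod (w $ i))\<^sup>2)"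
    by (intro sum_mono term_le)
  also have "\<dots> = vnorm2 u + vnorm2 w"
    using assms by (simp add: vnorm2_def sum.distrib)
  finally show ?thesis .
qed

section \<open>Adjoints and boundedness\<close>

lemma dim_mat_adjoint [simp]:
  "dim_row (mat_adjoint A) = dim_col A" "dim_col (mat_adjoint A) = dim_row A"
  by (simp_all add: mat_adjoint_def)

lemma index_mat_adjoint [simp]:
  fixes A :: "complex mat"
  shows "i < dim_col A \<Longrightarrow> j < dim_row A \<Longrightarrow> mat_adjoint A $$ (i, j) = cnj (A $$ (j, i))"
  by (simp add: mat_adjoint_def mat_of_rows_index)

lemma mat_adjoint_carrier [simp]:
  "A \<in> carrier_mat m n \<Longrightarrow> mat_adjoint A \<in> carrier_mat n m"
  by (rule carrier_matI) auto

lemma cscalar_prod_mat_adjoint: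
  fixes A :: "complex mat"
  assumes "A \<in> carrier_mat m n" "u \<in> carrier_vec m" "w \<in> carrier_vec n"
  shows "(mat_adjoint A *\<^sub>v u) \<bullet>c w = u \<bullet>c (A *\<^sub>v w)"
proof -
  have "(mat_adjoint A *\<^sub>v u) \<bullet>c w = (\<Sum>i<n. \<Sum>j<m. cnj (A $$ (j, i)) * u $ j * cnj (w $ i))"
    using assms by (simp add: scalar_prod_def atLeast0LessThan sum_distrib_right)
  also have "\<dots> = (\<Sum>j<m. \<Sum>i<n. cnj (A $$ (j, i)) * u $ j * cnj (w $ i))"
    by (rule sum.swap)
  also have "\<dots> = u \<bullet>c (A *\<^sub>v w)"
    using assms by (simp add: scalar_prod_def atLeast0LessThan sum_distrib_left mult_ac)
  finally show ?thesis .
qed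

text \<open>The constant is the squared Frobenius norm, by Cauchy-Schwarz in each row. Later
  arguments use only that some such constant exists.\<close>

lemma vnorm2_mult_mat_vec_le:
  fixes A :: "complex mat"
  assumes A: "A \<in> carrier_mat m n"
  obtains C where "0 \<le> C" "\<And>v. v \<in> carrier_vec n \<Longrightarrow> vnorm2 (A *\<^sub>v v) \<le> C * vnorm2 v"
proof
  let ?C = "\<Sum>i<m. \<Sum>j<n. (cmod (A $$ (i, j)))\<^sup>2"
  show "0 \<le> ?C" by (intro sum_nonneg) auto
  fix v :: "complex vec" assume v: "v \<in> carrier_vec n"
  have "vnorm2 (A *\<^sub>v v) = (\<Sum>i<m. (cmod (\<Sum>j<n. A $$ (i, j) * v $ j))\<^sup>2)"
    using A v by (simp add: vnorm2_def scalar_prod_def atLeast0LessThan)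
  also have "\<dots> \<le> (\<Sum>i<m. (\<Sum>j<n. (cmod (A $$ (i, j)))\<^sup>2) * vnorm2 v)"
  proof (rule sum_mono)
    fix i
    have "(cmod (\<Sum>j<n. A $$ (i, j) * v $ j))\<^sup>2 \<le> (\<Sum>j<n. cmod (A $$ (i, j)) * cmod (v $ j))\<^sup>2"
      by (intro power_mono order.trans[OF norm_sum]) (auto simp: norm_mult)
    also have "\<dots> \<le> (\<Sum>j<n. (cmod (A $$ (i, j)))\<^sup>2) * (\<Sum>j<n. (cmod (v $ j))\<^sup>2)"
      by (rule Cauchy_Schwarz_ineq_sum)
    finally show "(cmod (\<Sum>j<n. A $$ (i, j) * v $ j))\<^sup>2 \<le>
        (\<Sum>j<n. (cmod (A $$ (i, j)))\<^sup>2) * vnorm2 v"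
      using v by (simp add: vnorm2_def)
  qed
  finally show "vnorm2 (A *\<^sub>v v) \<le> ?C * vnorm2 v"
    by (simp add: sum_distrib_right)
qed

text \<open>
  The eigenvalue is the largest lower bound \<open>m\<close> of the Rayleigh quotient. If \<open>B = H - m\<close> were
  invertible, its quadratic form \<open>Q\<close> would satisfy \<open>\<parallel>B v\<parallel>\<^sup>2 \<le> D * Q v\<close> (as \<open>Q\<close> is nonnegative and bounded)
  and hence dominate a positive multiple of \<open>\<parallel>v\<parallel>\<^sup>2\<close>, so that \<open>m\<close> could be increased.
\<close>

lemma hermitian_least_eigenvalue:
  fixes H :: "complex mat"
  assumes H: "H \<in> carrier_mat n n" and "0 < n"
    and herm: "\<And>u w. u \<in> carrier_vec n \<Longrightarrow> w \<in> carrier_vec n \<Longrightarrow> (H *\<^sub>v u) \<bullet>c w = u \<bullet>c (H *\<^sub>v w)"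
  obtains m :: real where "eigenvalue H (of_real m)"
    "\<And>v. v \<in> carrier_vec n \<Longrightarrow> m * vnorm2 v \<le> Re ((H *\<^sub>v v) \<bullet>c v)"
proof -
  define S where "S = {m. \<forall>v \<in> carrier_vec n. m * vnorm2 v \<le> Re ((H *\<^sub>v v) \<bullet>c v)}"
  define m where "m = Sup S"
  obtain C where C: "0 \<le> C" "\<And>v. v \<in> carrier_vec n \<Longrightarrow> vnorm2 (H *\<^sub>v v) \<le> C * vnorm2 v"
    using vnorm2_mult_mat_vec_le[OF H] by blast
  \<comment> \<open>Boundedness of \<open>H\<close> bounds the Rayleigh quotient from below, so the
    set of lower bounds is not empty.\<close>
  have "- (C + 1) \<in> S"
    unfolding S_def
  proof (intro CollectI ballI)
    fix v :: "complex vec" assume v: "v \<in> carrier_vec n"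
    have "2 * \<bar>Re ((H *\<^sub>v v) \<bullet>c v)\<bar> \<le> (C + 1) * vnorm2 v"
      using two_abs_Re_cscalar_prod_le[of "H *\<^sub>v v" n v] C(2)[OF v] H v
      by (simp add: algebra_simps)
    moreover have "0 \<le> (C + 1) * vnorm2 v" using C(1) by simp
    ultimately show "- (C + 1) * vnorm2 v \<le> Re ((H *\<^sub>v v) \<bullet>c v)"
      unfolding mult_minus_left by linarith
  qed
  then have S_ne: "S \<noteq> {}" by auto
  have le_rayleigh: "x \<le> Re ((H *\<^sub>v v) \<bullet>c v) / vnorm2 v"
    if "x \<in> S" "v \<in> carrier_vec n" "0 < vnorm2 v" for x v
    using that by (simp add: S_def field_simps)
  \<comment> \<open>The Rayleigh quotient of one nonzero vector, available as \<open>0 < n\<close>,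
    bounds \<open>S\<close> from above.\<close>
  have unit: "unit_vec n 0 \<in> carrier_vec n" "0 < vnorm2 (unit_vec n 0)"
    using \<open>0 < n\<close> by (auto intro!: vnorm2_pos[of _ n])
  have S_bdd: "bdd_above S"
    using le_rayleigh[OF _ unit] by (auto simp: bdd_above_def)
  have m_le: "m * vnorm2 v \<le> Re ((H *\<^sub>v v) \<bullet>c v)" if v: "v \<in> carrier_vec n" for v
  proof (cases "vnorm2 v = 0")
    case True
    with S_ne v show ?thesis by (auto simp: S_def)
  next
    case False
    then have pos: "0 < vnorm2 v" by (simp add: less_le)
    have "m \<le> Re ((H *\<^sub>v v) \<bullet>c v) / vnorm2 v"
      unfolding m_def by (intro cSup_least S_ne le_rayleigh v pos)
    with pos show ?thesis by (simp add: field_simps)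
  qed
  have "eigenvalue H (of_real m)"
  proof (rule ccontr)
    assume not_ev: "\<not> eigenvalue H (of_real m)"
    define B where "B = char_matrix H (of_real m)"
    have B: "B \<in> carrier_mat n n" using H by (simp add: B_def)
    have "det B \<noteq> 0" using not_ev eigenvalue_det[OF H] by (simp add: B_def)
    then obtain K where K: "K \<in> carrier_mat n n" "K * B = 1\<^sub>m n"
      using det_non_zero_imp_unit[OF B] by (auto simp: Units_def ring_mat_def)
    have B_mult: "B *\<^sub>v v = H *\<^sub>v v + (- of_real m) \<cdot>\<^sub>v v" if "v \<in> carrier_vec n" for v
    proof -
      have "((- of_real m) \<cdot>\<^sub>m 1\<^sub>m n) *\<^sub>v v = (- of_real m) \<cdot>\<^sub>v v"
        using that by (intro eq_vecI) auto
      moreover have "B = H + (- of_real m) \<cdot>\<^sub>m 1\<^sub>m n"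
        using H by (simp add: B_def char_matrix_def)
      ultimately show ?thesis
        using add_mult_distrib_mat_vec[OF H _ that, of "(- of_real m) \<cdot>\<^sub>m 1\<^sub>m n"] by simp
    qed
    have Bv [simp]: "B *\<^sub>v v \<in> carrier_vec n" for v using B by (intro carrier_vecI) auto
    have Hv [simp]: "H *\<^sub>v v \<in> carrier_vec n" for v using H by (intro carrier_vecI) auto
    define Q where "Q v = Re ((B *\<^sub>v v) \<bullet>c v)" for v
    have herm_B: "(B *\<^sub>v u) \<bullet>c w = u \<bullet>c (B *\<^sub>v w)" if "u \<in> carrier_vec n" "w \<in> carrier_vec n" for u w
      using that by (simp add: B_mult herm conjugate_add_vec[of _ n] conjugate_smult_vec
         add_scalar_prod_distrib[of _ n] scalar_prod_add_distrib[of _ n])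
    have Q_eq: "Q v = Re ((H *\<^sub>v v) \<bullet>c v) - m * vnorm2 v" if "v \<in> carrier_vec n" for v
      using that by (simp add: Q_def B_mult add_scalar_prod_distrib[of _ n] cscalar_prod_self)
    have Q_nonneg: "0 \<le> Q v" if "v \<in> carrier_vec n" for v
      using m_le[OF that] Q_eq[OF that] by simp
    obtain C where C: "0 \<le> C" "\<And>v. v \<in> carrier_vec n \<Longrightarrow> vnorm2 (B *\<^sub>v v) \<le> C * vnorm2 v"
      using vnorm2_mult_mat_vec_le[OF B] by blast
    define D where "D = C + 1"
    have D: "0 < D" using C by (simp add: D_def)
    have Q_le: "Q v \<le> D * vnorm2 v" if v: "v \<in> carrier_vec n" for v
    proof -
      have "2 * \<bar>Q v\<bar> \<le> D * vnorm2 v"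
        using two_abs_Re_cscalar_prod_le[of "B *\<^sub>v v" n v] C(2)[OF v] v
        by (simp add: Q_def D_def algebra_simps)
      moreover have "0 \<le> D * vnorm2 v" using D by simp
      ultimately show ?thesis by linarith
    qed
    have B_le_Q: "vnorm2 (B *\<^sub>v v) \<le> D * Q v" if v: "v \<in> carrier_vec n" for v
    proof -
      let ?b = "vnorm2 (B *\<^sub>v v)"
      \<comment> \<open>This \<open>t\<close> minimises
        \<open>Q v + 2 * t * ?b + t\<^sup>2 * (D * ?b)\<close>, an upper bound for the nonnegative
        \<open>Q (v + w)\<close>; nonnegativity of the minimum is the claim.\<close>
      define t where "t = - 1 / D"
      define w where "w = complex_of_real t \<cdot>\<^sub>v (B *\<^sub>v v)"
      have w: "w \<in> carrier_vec n" by (simp add: w_def)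
      have Bw: "B *\<^sub>v w = complex_of_real t \<cdot>\<^sub>v (B *\<^sub>v (B *\<^sub>v v))"
        unfolding w_def by (rule mult_mat_vec[OF B]) simp
      have "(B *\<^sub>v v) \<bullet>c w = of_real (t * ?b)"
        by (simp add: w_def conjugate_smult_vec cscalar_prod_self)
      moreover have "(B *\<^sub>v w) \<bullet>c v = of_real (t * ?b)"
        unfolding herm_B[OF w v] by (simp add: w_def cscalar_prod_self)
      moreover have "Re ((B *\<^sub>v w) \<bullet>c w) = t\<^sup>2 * Q (B *\<^sub>v v)"
        unfolding Bw by (simp add: w_def Q_def conjugate_smult_vec power2_eq_square)
      ultimately have "Q (v + w) = Q v + 2 * t * ?b + t\<^sup>2 * Q (B *\<^sub>v v)"
        using v w B by (simp add: Q_def mult_add_distrib_mat_vec[of _ n n] conjugate_add_vec[of _ n]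
            add_scalar_prod_distrib[of _ n] scalar_prod_add_distrib[of _ n])
      moreover have "t\<^sup>2 * Q (B *\<^sub>v v) \<le> t\<^sup>2 * (D * ?b)"
        by (intro mult_left_mono Q_le) simp_all
      moreover have "0 \<le> Q (v + w)" using v w by (intro Q_nonneg) simp
      ultimately have "0 \<le> Q v + 2 * t * ?b + t\<^sup>2 * (D * ?b)" by linarith
      then show ?thesis using D by (simp add: t_def field_simps power2_eq_square)
    qed
    obtain C' where C': "0 \<le> C'" "\<And>v. v \<in> carrier_vec n \<Longrightarrow> vnorm2 (K *\<^sub>v v) \<le> C' * vnorm2 v"
      using vnorm2_mult_mat_vec_le[OF K(1)] by blast
    \<comment> \<open>The summand 1 makes \<open>E\<close> positive, as \<open>C' * D\<close> is
      only known to be nonnegative.\<close>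
    define E where "E = C' * D + 1"
    have E: "0 < E" using C' D by (simp add: E_def add_nonneg_pos)
    have "m + 1 / E \<in> S"
      unfolding S_def
    proof (intro CollectI ballI)
      fix v :: "complex vec" assume v: "v \<in> carrier_vec n"
      have "v = K *\<^sub>v (B *\<^sub>v v)"
        using v K B by (simp flip: assoc_mult_mat_vec)
      then have "vnorm2 v \<le> C' * vnorm2 (B *\<^sub>v v)"
        using C'(2)[of "B *\<^sub>v v"] by simp
      also have "\<dots> \<le> C' * (D * Q v)"
        by (intro mult_left_mono B_le_Q v C')
      also have "\<dots> \<le> E * Q v"
        using Q_nonneg[OF v] by (simp add: E_def algebra_simps)
      finally have "vnorm2 v / E \<le> Q v" using E by (simp add: field_simps)
      then show "(m + 1 / E) * vnorm2 v \<le> Re ((H *\<^sub>v v) \<bullet>c v)"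
        using Q_eq[OF v] by (simp add: algebra_simps)
    qed
    then have "m + 1 / E \<le> m" unfolding m_def by (intro cSup_upper S_bdd)
    with E show False by simp
  qed
  with m_le show ?thesis using that by blast
qed

section \<open>Singular values and eigenvalues of the Gram matrix\<close>

lemma set_singular_values:
  assumes "A \<in> carrier_mat p q" "q \<le> p"
  shows "set (singular_values A) = (\<lambda>x. sqrt (Re x)) ` {x. eigenvalue (mat_adjoint A * A) x}"
proof -
  let ?G = "mat_adjoint A * A"
  have G: "?G \<in> carrier_mat q q" "gram_mat A = ?G"
    using assms by (auto simp: gram_mat_def)
  \<comment> \<open>\<open>proots\<close> collects all roots only for a nonzero polynomial; a
    characteristic polynomial is monic.\<close>
  have "char_poly ?G \<noteq> 0"
    using degree_monic_char_poly[OF G(1)] by auto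
  then show ?thesis
    by (simp add: singular_values_def G(2) eigenvalue_root_char_poly[OF G(1)])
qed

lemma singular_values_between:
  assumes "x \<in> set (singular_values A)"
  shows "x \<le> hd (singular_values A)" and "last (singular_values A) \<le> x"
proof -
  define xs where "xs = rev (singular_values A)"
  have xs: "sorted xs" "x \<in> set xs" "singular_values A = rev xs"
    using assms by (auto simp: xs_def singular_values_def)
  then have "xs \<noteq> []" by auto
  from xs(2) obtain i where i: "i < length xs" "x = xs ! i"
    by (auto simp: in_set_conv_nth)
  have "xs ! 0 \<le> xs ! i" "xs ! i \<le> xs ! (length xs - 1)"
    using i xs(1) by (auto intro: sorted_nth_mono)
  with \<open>xs \<noteq> []\<close> show "x \<le> hd (singular_values A)" "last (singular_values A) \<le> x"
    by (simp_all add: xs(3) i(2) hd_rev last_rev last_conv_nth hd_conv_nth)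
qed

text \<open>The extreme eigenvalues of the Gram matrix bound every Rayleigh quotient, so any two
  vectors give a lower bound. Injectivity excludes a vanishing least singular value, for which
  \<open>condition_number\<close> takes the default value 0.\<close>

lemma condition_number_ge_rayleigh:
  fixes A :: "complex mat"
  assumes A: "A \<in> carrier_mat p q" and q: "0 < q" "q \<le> p"
    and inj: "\<And>w. w \<in> carrier_vec q \<Longrightarrow> A *\<^sub>v w = 0\<^sub>v p \<Longrightarrow> w = 0\<^sub>v q"
    and u: "u \<in> carrier_vec q" "u \<noteq> 0\<^sub>v q"
    and v: "v \<in> carrier_vec q" "v \<noteq> 0\<^sub>v q"
  shows "sqrt (vnorm2 (A *\<^sub>v u) / vnorm2 u * (vnorm2 v / vnorm2 (A *\<^sub>v v))) \<le> condition_number A"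
proof -
  define G where "G = mat_adjoint A * A"
  have G: "G \<in> carrier_mat q q" unfolding G_def by (rule mult_carrier_mat[OF mat_adjoint_carrier[OF A] A])
  have G_prod: "(G *\<^sub>v x) \<bullet>c y = (A *\<^sub>v x) \<bullet>c (A *\<^sub>v y)"
    if "x \<in> carrier_vec q" "y \<in> carrier_vec q" for x y
  proof -
    have "G *\<^sub>v x = mat_adjoint A *\<^sub>v (A *\<^sub>v x)"
      unfolding G_def by (rule assoc_mult_mat_vec[OF mat_adjoint_carrier[OF A] A that(1)])
    then show ?thesis
      using cscalar_prod_mat_adjoint[OF A _ that(2), of "A *\<^sub>v x"] A that by simp
  qed
  have G_herm: "(G *\<^sub>v x) \<bullet>c y = x \<bullet>c (G *\<^sub>v y)"
    if "x \<in> carrier_vec q" "y \<in> carrier_vec q" for x y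
  proof -
    have Gx: "G *\<^sub>v z \<in> carrier_vec q" for z using G by (intro carrier_vecI) auto
    have "x \<bullet>c (G *\<^sub>v y) = conjugate ((G *\<^sub>v y) \<bullet>c x)"
      using cscalar_prod_commute[OF that(1) Gx] .
    also have "\<dots> = conjugate ((A *\<^sub>v y) \<bullet>c (A *\<^sub>v x))"
      using that by (simp add: G_prod)
    also have "\<dots> = (A *\<^sub>v x) \<bullet>c (A *\<^sub>v y)"
      using cscalar_prod_commute[of "A *\<^sub>v x" p "A *\<^sub>v y"] A that by simp
    finally show ?thesis using that by (simp add: G_prod)
  qed
  have Gq: "Re ((G *\<^sub>v x) \<bullet>c x) = vnorm2 (A *\<^sub>v x)" if "x \<in> carrier_vec q" for x
    using that by (simp add: G_prod cscalar_prod_self)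
  obtain m where m: "eigenvalue G (of_real m)"
    "\<And>x. x \<in> carrier_vec q \<Longrightarrow> m * vnorm2 x \<le> vnorm2 (A *\<^sub>v x)"
    using hermitian_least_eigenvalue[OF G q(1) G_herm] Gq by (metis (no_types, lifting))
  \<comment> \<open>The greatest eigenvalue of \<open>G\<close> is obtained as minus the least
    eigenvalue of \<open>- G\<close>.\<close>
  have mG: "- G \<in> carrier_mat q q" using G by simp
  have mG_mult: "(- G) *\<^sub>v x = - (G *\<^sub>v x)" if "x \<in> carrier_vec q" for x
    using G that by simp
  have mG_herm: "((- G) *\<^sub>v x) \<bullet>c y = x \<bullet>c ((- G) *\<^sub>v y)"
    if "x \<in> carrier_vec q" "y \<in> carrier_vec q" for x y
    using G that by (simp add: mG_mult G_herm uminus_conjugate_vec[symmetric])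
  obtain l where l: "eigenvalue (- G) (of_real l)"
    "\<And>x. x \<in> carrier_vec q \<Longrightarrow> l * vnorm2 x \<le> Re (((- G) *\<^sub>v x) \<bullet>c x)"
    using hermitian_least_eigenvalue[OF mG q(1) mG_herm] by metis
  define M where "M = - l"
  have M: "vnorm2 (A *\<^sub>v x) \<le> M * vnorm2 x" if "x \<in> carrier_vec q" for x
    using l(2)[OF that] G that by (simp add: M_def mG_mult Gq)
  have "eigenvalue G (of_real M)"
  proof -
    obtain x where x: "x \<in> carrier_vec q" "x \<noteq> 0\<^sub>v q" "- (G *\<^sub>v x) = of_real l \<cdot>\<^sub>v x"
      using l(1) G by (auto simp: eigenvalue_def eigenvector_def)
    have "G *\<^sub>v x = - (- (G *\<^sub>v x))" by simp
    also have "\<dots> = of_real M \<cdot>\<^sub>v x"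
      unfolding x(3) M_def using x(1) by (intro eq_vecI) auto
    finally show ?thesis
      using x G by (auto simp: eigenvalue_def eigenvector_def)
  qed
  have Av_pos: "0 < vnorm2 (A *\<^sub>v x)" if "x \<in> carrier_vec q" "x \<noteq> 0\<^sub>v q" for x
    using that inj[of x] A by (intro vnorm2_pos[of _ p]) auto
  \<comment> \<open>For an eigenvector \<open>x\<close>, the form
    \<open>vnorm2 (A *\<^sub>v x)\<close>, positive by injectivity, equals
    \<open>Re e * vnorm2 x\<close>.\<close>
  have ev_pos: "0 < Re e" if e: "eigenvalue G e" for e
  proof -
    obtain x where x: "x \<in> carrier_vec q" "x \<noteq> 0\<^sub>v q" "G *\<^sub>v x = e \<cdot>\<^sub>v x"
      using e G by (auto simp: eigenvalue_def eigenvector_def)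
    have "vnorm2 (A *\<^sub>v x) = Re (e * of_real (vnorm2 x))"
      using Gq[OF x(1)] x by (simp add: cscalar_prod_self)
    also have "\<dots> = Re e * vnorm2 x" by simp
    finally have "0 < Re e * vnorm2 x" using Av_pos[OF x(1,2)] by simp
    then show ?thesis using vnorm2_pos[OF x(1,2)] by (simp add: zero_less_mult_iff)
  qed
  have sv: "set (singular_values A) = (\<lambda>x. sqrt (Re x)) ` {x. eigenvalue G x}"
    unfolding G_def by (rule set_singular_values[OF A q(2)])
  have "sqrt M \<in> set (singular_values A)" "sqrt m \<in> set (singular_values A)"
    unfolding sv using \<open>eigenvalue G (of_real M)\<close> m(1) by force+
  then have hd_ge: "sqrt M \<le> hd (singular_values A)" and last_le: "last (singular_values A) \<le> sqrt m"
    and "singular_values A \<noteq> []"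
    using singular_values_between by auto
  then have "last (singular_values A) \<in> set (singular_values A)" by simp
  then have last_pos: "0 < last (singular_values A)"
    unfolding sv using ev_pos by auto
  have pos: "0 < M" "0 < m"
    using ev_pos[OF \<open>eigenvalue G (of_real M)\<close>] ev_pos[OF m(1)] by simp_all
  have "vnorm2 (A *\<^sub>v u) / vnorm2 u \<le> M" "vnorm2 v / vnorm2 (A *\<^sub>v v) \<le> 1 / m"
    using M[OF u(1)] m(2)[OF v(1)] vnorm2_pos[OF u] Av_pos[OF v] pos
    by (simp_all add: field_simps)
  then have "vnorm2 (A *\<^sub>v u) / vnorm2 u * (vnorm2 v / vnorm2 (A *\<^sub>v v)) \<le> M * (1 / m)"
    using pos by (intro mult_mono) auto
  then have "sqrt (vnorm2 (A *\<^sub>v u) / vnorm2 u * (vnorm2 v / vnorm2 (A *\<^sub>v v))) \<le> sqrt M / sqrt m"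
    by (simp flip: real_sqrt_divide)
  also have "\<dots> \<le> hd (singular_values A) / last (singular_values A)"
    using hd_ge last_le last_pos pos order.trans[OF real_sqrt_ge_zero hd_ge] by (intro frac_le) auto
  finally show ?thesis by (simp add: condition_number_def)
qed

subsection \<open>Submatrices of the Fourier matrix\<close>

text \<open>\<open>pick\<close> lists a set in increasing order, whereas a run that wraps around is
  increasing only cyclically; the permutation \<open>\<rho>\<close> translates between the two
  orders. By \<open>p < N\<close> the residues are distinct.\<close>

lemma cyclic_run_pick:
  assumes "cyclic_run N p I" "p < N"
  obtains s \<rho> where "bij_betw \<rho> {..<p} {..<p}" "card {i. i < N \<and> i \<in> I} = p"
    "\<And>i. i < p \<Longrightarrow> pick I i = (s + \<rho> i) mod N"
proof -
  obtain s where I: "I = (\<lambda>i. (s + i) mod N) ` {..<p}"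
    using assms(1) by (auto simp: cyclic_run_def)
  define \<sigma> where "\<sigma> i = (s + i) mod N" for i
  have \<sigma>_neq: "\<sigma> i \<noteq> \<sigma> j" if "i < j" "j < p" for i j
  proof
    assume "\<sigma> i = \<sigma> j"
    then have "(s + j) mod N = (s + i) mod N" by (simp add: \<sigma>_def)
    then have "N dvd (s + j) - (s + i)"
      using mod_eq_dvd_iff_nat[of "s + i" "s + j" N] that by simp
    then show False using that assms(2) nat_dvd_not_less[of "j - i" N] by simp
  qed
  have "inj_on \<sigma> {..<p}"
  proof (rule inj_onI)
    fix i j assume "i \<in> {..<p}" "j \<in> {..<p}" "\<sigma> i = \<sigma> j"
    then show "i = j" using \<sigma>_neq[of i j] \<sigma>_neq[of j i] by (cases i j rule: linorder_cases) auto
  qed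
  then have bij: "bij_betw \<sigma> {..<p} I"
    by (auto simp: bij_betw_def I \<sigma>_def[abs_def])
  then have card_I: "card I = p" using bij_betw_same_card by fastforce
  have I_eq: "{i. i < N \<and> i \<in> I} = I" using assms(2) by (auto simp: I)
  have pick_in: "pick I i \<in> I" if "i < p" for i
    using that by (simp add: pick_in_set_le card_I)
  have "inj_on (pick I) {..<p}"
  proof (rule inj_onI)
    fix i j assume "i \<in> {..<p}" "j \<in> {..<p}" "pick I i = pick I j"
    then show "i = j"
      using pick_mono_le[of j I i] pick_mono_le[of i I j] card_I by (cases i j rule: linorder_cases) auto
  qed
  moreover have "pick I ` {..<p} = I"
    using calculation pick_in card_I I by (intro card_subset_eq) (auto simp: card_image)
  ultimately have "bij_betw (pick I) {..<p} I" by (simp add: bij_betw_def)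
  then have "bij_betw (the_inv_into {..<p} \<sigma> \<circ> pick I) {..<p} {..<p}"
    by (rule bij_betw_trans) (rule bij_betw_the_inv_into[OF bij])
  moreover have "pick I i = (s + (the_inv_into {..<p} \<sigma> \<circ> pick I) i) mod N" if "i < p" for i
    using f_the_inv_into_f_bij_betw[OF bij, of "pick I i"] pick_in[OF that] by (simp add: \<sigma>_def)
  ultimately show ?thesis using that card_I I_eq by metis
qed

lemma cis_two_pi_cong:
  assumes "0 < N" "x mod int N = y mod int N"
  shows "cis (2 * pi * of_int x / real N) = cis (2 * pi * of_int y / real N)"
proof -
  obtain z where z: "x = y + int N * z"
    using assms(2) by (metis mod_eqE)
  have "2 * pi * of_int x / real N = 2 * pi * of_int y / real N + 2 * pi * of_int z"
    using assms(1) by (simp add: z field_simps)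
  then have "cis (2 * pi * of_int x / real N) = cis (2 * pi * of_int y / real N) * cis (2 * pi * of_int z)"
    by (simp only: cis_mult)
  then show ?thesis by simp
qed

text \<open>Entries depend on the labels only modulo \<open>N\<close>, so the wrap-around
  disappears: the labels may be taken as consecutive integers from \<open>s\<close> and
  \<open>t\<close> on, listed in the orders \<open>\<rho>\<close> and \<open>\<pi>\<close>.\<close>

lemma cyclically_contiguous_submatrix_dft_mat:
  assumes "cyclically_contiguous_submatrix p q (dft_mat N) A" "p < N" "q < N"
  obtains s t :: int and \<rho> \<pi> where "A \<in> carrier_mat p q"
    "bij_betw \<rho> {..<p} {..<p}" "bij_betw \<pi> {..<q} {..<q}"
    "\<And>i k. i < p \<Longrightarrow> k < q \<Longrightarrow>
      A $$ (i, k) = cis (2 * pi * of_int ((s + int (\<rho> i)) * (t + int (\<pi> k))) / real N)"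
proof -
  have dim: "dim_row (dft_mat N) = N" "dim_col (dft_mat N) = N"
    by (simp_all add: dft_mat_def)
  obtain I J where I: "cyclic_run N p I" and J: "cyclic_run N q J" and A_eq: "A = submatrix (dft_mat N) I J"
    using assms(1) by (auto simp: cyclically_contiguous_submatrix_def dim)
  obtain s \<rho> where \<rho>: "bij_betw \<rho> {..<p} {..<p}" "card {i. i < N \<and> i \<in> I} = p"
    "\<And>i. i < p \<Longrightarrow> pick I i = (s + \<rho> i) mod N"
    using cyclic_run_pick[OF I assms(2)] by blast
  obtain t \<pi> where \<pi>: "bij_betw \<pi> {..<q} {..<q}" "card {i. i < N \<and> i \<in> J} = q"
    "\<And>i. i < q \<Longrightarrow> pick J i = (t + \<pi> i) mod N"
    using cyclic_run_pick[OF J assms(3)] by blast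
  have A: "A \<in> carrier_mat p q"
    by (intro carrier_matI) (simp_all add: A_eq dim_submatrix dim \<rho>(2) \<pi>(2))
  have "A $$ (i, k) = cis (2 * pi * of_int ((dft_index N s + int (\<rho> i)) * (dft_index N t + int (\<pi> k))) / real N)"
    if ik: "i < p" "k < q" for i k
  proof -
    have N: "0 < N" using assms by simp
    let ?x = "dft_index N ((s + \<rho> i) mod N)" and ?y = "dft_index N ((t + \<pi> k) mod N)"
    have "A $$ (i, k) = dft_mat N $$ ((s + \<rho> i) mod N, (t + \<pi> k) mod N)"
      unfolding A_eq using ik by (subst submatrix_index) (simp_all add: dim \<rho> \<pi>)
    also have "\<dots> = exp (2 * of_real pi * \<i> * of_int ?x * of_int ?y / of_nat N)"
      using N by (simp add: dft_mat_def)
    also have "\<dots> = cis (2 * pi * of_int (?x * ?y) / real N)"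
      by (simp add: cis_conv_exp mult_ac)
    also have "\<dots> = cis (2 * pi * of_int ((dft_index N s + int (\<rho> i)) * (dft_index N t + int (\<pi> k))) / real N)"
    proof (rule cis_two_pi_cong[OF N], rule mod_mult_cong)
      show "?x mod int N = (dft_index N s + int (\<rho> i)) mod int N"
        by (simp add: dft_index_def zmod_int mod_diff_left_eq algebra_simps)
      show "?y mod int N = (dft_index N t + int (\<pi> k)) mod int N"
        by (simp add: dft_index_def zmod_int mod_diff_left_eq algebra_simps)
    qed
    finally show ?thesis .
  qed
  with A \<rho>(1) \<pi>(1) show ?thesis by (rule that)
qed

section \<open>Polynomial evaluation at the nodes\<close>

lemma poly_eq_sum_lessThan:
  fixes P :: "'a :: comm_semiring_1 poly"
  assumes "degree P < q"
  shows "poly P z = (\<Sum>l<q. coeff P l * z ^ l)"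
  unfolding poly_altdef using assms
  by (intro sum.mono_neutral_left) (auto simp: coeff_eq_0)

text \<open>Here \<open>s\<close> is the full label of row \<open>i\<close>. Splitting off the
  factor of the first column label \<open>t\<close> leaves powers of the node. The weights
  \<open>cis (- \<phi>) ^ \<pi> k\<close> rotate the node, which later centres the arc at angle
  0.\<close>

lemma cis_mult_vec_eq_poly:
  fixes s t :: int
  assumes A: "A \<in> carrier_mat p q" and \<pi>: "bij_betw \<pi> {..<q} {..<q}"
    and entries: "\<And>k. k < q \<Longrightarrow> A $$ (i, k) = cis (2 * pi * of_int (s * (t + int (\<pi> k))) / real N)"
    and P: "degree P < q" and i: "i < p"
  shows "(A *\<^sub>v vec q (\<lambda>k. coeff P (\<pi> k) * cis (- \<phi>) ^ \<pi> k)) $ i =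
    cis (2 * pi * of_int (s * t) / real N) * poly P (cis (2 * pi * of_int s / real N - \<phi>))"
proof -
  define z where "z = cis (2 * pi * of_int s / real N)"
  have entry: "A $$ (i, k) = cis (2 * pi * of_int (s * t) / real N) * z ^ \<pi> k" if "k < q" for k
    unfolding entries[OF that] z_def DeMoivre cis_mult
    by (rule arg_cong[where f = cis]) (simp add: algebra_simps add_divide_distrib)
  have "(A *\<^sub>v vec q (\<lambda>k. coeff P (\<pi> k) * cis (- \<phi>) ^ \<pi> k)) $ i =
      (\<Sum>k<q. A $$ (i, k) * (coeff P (\<pi> k) * cis (- \<phi>) ^ \<pi> k))"
    using A i by (simp add: scalar_prod_def atLeast0LessThan)
  also have "\<dots> = (\<Sum>k<q. cis (2 * pi * of_int (s * t) / real N) * (coeff P (\<pi> k) * (z * cis (- \<phi>)) ^ \<pi> k))"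
    by (intro sum.cong) (simp_all add: entry power_mult_distrib mult_ac)
  also have "\<dots> = (\<Sum>l<q. cis (2 * pi * of_int (s * t) / real N) * (coeff P l * (z * cis (- \<phi>)) ^ l))"
    by (rule sum.reindex_bij_betw[OF \<pi>])
  also have "\<dots> = cis (2 * pi * of_int (s * t) / real N) * poly P (z * cis (- \<phi>))"
    by (simp add: poly_eq_sum_lessThan[OF P] sum_distrib_left)
  also have "z * cis (- \<phi>) = cis (2 * pi * of_int s / real N - \<phi>)"
    by (simp add: z_def cis_mult)
  finally show ?thesis .
qed

lemma inj_on_cis_shifted_roots:
  assumes "p \<le> N"
  shows "inj_on (\<lambda>r. cis (2 * pi * of_int (s + int r) / real N)) {..<p}"
proof (cases "N = 0")
  case False
  then have "inj_on (\<lambda>r. cis (2 * pi * real r / real N)) {..<N}"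
    using bij_betw_roots_unity[of N] by (auto simp: bij_betw_def)
  then have "inj_on (\<lambda>r. cis (2 * pi * real r / real N)) {..<p}"
    using assms by (auto intro: inj_on_subset)
  moreover have "cis (2 * pi * of_int (s + int r) / real N) =
      cis (2 * pi * of_int s / real N) * cis (2 * pi * real r / real N)" for r
    by (simp add: cis_mult add_divide_distrib[symmetric] distrib_left)
  ultimately show ?thesis by (auto simp: inj_on_def)
qed (use assms in auto)

text \<open>A Vandermonde argument: a kernel vector is the coefficient list of a polynomial of
  degree below \<open>q \<le> p\<close> that vanishes at \<open>p\<close> distinct nodes.\<close>

lemma cyclically_contiguous_submatrix_dft_mat_inj:
  assumes "cyclically_contiguous_submatrix p q (dft_mat N) A" "q \<le> p" "p < N" "0 < q"
    and w: "w \<in> carrier_vec q" "A *\<^sub>v w = 0\<^sub>v p"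
  shows "w = 0\<^sub>v q"
proof -
  have "q < N" using assms by simp
  obtain s t :: int and \<rho> \<pi> :: "nat \<Rightarrow> nat" where A: "A \<in> carrier_mat p q"
    and \<rho>: "bij_betw \<rho> {..<p} {..<p}" and \<pi>: "bij_betw \<pi> {..<q} {..<q}"
    and entries: "\<And>i k. i < p \<Longrightarrow> k < q \<Longrightarrow>
      A $$ (i, k) = cis (2 * pi * of_int ((s + int (\<rho> i)) * (t + int (\<pi> k))) / real N)"
    by (rule cyclically_contiguous_submatrix_dft_mat[OF assms(1,3) \<open>q < N\<close>]) (rule that)
  define P where "P = (\<Sum>k<q. monom (w $ k) (\<pi> k))"
  have \<pi>_less: "\<pi> k < q" if "k < q" for k using \<pi> that by (auto simp: bij_betw_def)
  have coeff_P: "coeff P (\<pi> k) = w $ k" if "k < q" for k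
  proof -
    have "coeff P (\<pi> k) = (\<Sum>j<q. if j = k then w $ j else 0)"
      unfolding P_def coeff_sum coeff_monom
      using \<pi> that by (intro sum.cong) (auto simp: bij_betw_def inj_on_def)
    then show ?thesis using that by simp
  qed
  have "degree P \<le> q - 1"
    unfolding P_def using \<pi>_less
    by (intro degree_sum_le) (fastforce intro: order.trans[OF degree_monom_le])+
  then have deg: "degree P < q" using assms(4) by simp
  \<comment> \<open>The trivial rotation by angle 0 brings \<open>w\<close> into the form required
    by the evaluation lemma.\<close>
  have w_eq: "w = vec q (\<lambda>k. coeff P (\<pi> k) * cis (- 0) ^ \<pi> k)"
    using w(1) by (intro eq_vecI) (auto simp: coeff_P)
  let ?z = "\<lambda>r. cis (2 * pi * of_int (s + int r) / real N)"
  have root: "poly P (?z (\<rho> i)) = 0" if "i < p" for i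
  proof -
    have "(A *\<^sub>v w) $ i = 0" using w(2) that by simp
    then show ?thesis
      using cis_mult_vec_eq_poly[OF A \<pi> entries[OF that] deg that, of 0] w_eq by simp
  qed
  have "P = 0"
  proof (rule poly_eqI_degree[where A = "?z ` {..<p}"])
    show "poly P x = poly 0 x" if x: "x \<in> ?z ` {..<p}" for x
    proof -
      obtain r where r: "r < p" "x = ?z r" using x by auto
      then have "r \<in> \<rho> ` {..<p}" using \<rho> by (simp add: bij_betw_def)
      then show ?thesis using root r(2) by auto
    qed
    have "card (?z ` {..<p}) = p"
      using inj_on_cis_shifted_roots[of p N s] assms(3) by (simp add: card_image)
    then show "degree P < card (?z ` {..<p})" "degree 0 < card (?z ` {..<p})"
      using deg assms(2) by simp_all
  qed
  then show ?thesis using w_eq by (intro eq_vecI) auto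
qed

section \<open>The test vectors and the bound by cosh\<close>

lemma condition_number_dft_submatrix_ge_cosh:
  assumes q: "1 \<le> q" "q \<le> p" and N: "p < N"
    and sub: "cyclically_contiguous_submatrix p q (dft_mat N) A"
  shows "cosh (real (q - 1) * (pi / 2 * (1 - real p / real N))) / sqrt (real q) \<le> condition_number A"
proof -
  have qN: "q < N" and q0: "0 < q" and p0: "0 < p" using q N by simp_all
  obtain s t :: int and \<rho> \<pi> :: "nat \<Rightarrow> nat" where A: "A \<in> carrier_mat p q"
    and \<rho>: "bij_betw \<rho> {..<p} {..<p}" and \<pi>: "bij_betw \<pi> {..<q} {..<q}"
    and entries: "\<And>i k. i < p \<Longrightarrow> k < q \<Longrightarrow>
      A $$ (i, k) = cis (2 * pi * of_int ((s + int (\<rho> i)) * (t + int (\<pi> k))) / real N)"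
    by (rule cyclically_contiguous_submatrix_dft_mat[OF sub N qN]) (rule that)
  note inj = cyclically_contiguous_submatrix_dft_mat_inj[OF sub q(2) N q0]
  define x where "x = pi / 2 * (1 - real p / real N)"
  define D where "D = cosh (real (q - 1) * x)"
  \<comment> \<open>\<open>\<alpha>\<close> bounds the half angles of the centred nodes. It is
    complementary to \<open>x\<close>, so the arc is described by
    \<open>sin \<alpha> = cos x\<close>.\<close>
  define \<alpha> where "\<alpha> = pi * real p / (2 * real N)"
  define P where "P = arc_chebyshev (1 / (2 * \<i> * of_real (cos x))) (q - 1)"
  have \<alpha>: "0 < \<alpha>" "\<alpha> < pi / 2" "x = pi / 2 - \<alpha>"
    using N p0 by (simp_all add: \<alpha>_def x_def field_simps)
  then have x: "0 \<le> x" "x < pi / 2" by simp_all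
  have cos_x: "cos x = sin \<alpha>" unfolding \<alpha>(3) by (simp add: cos_diff)
  have cos_pos: "0 < cos x" unfolding cos_x using \<alpha> by (intro sin_gt_zero) auto
  have deg: "degree P < q"
    using degree_arc_chebyshev_le[of "1 / (2 * \<i> * of_real (cos x))" "q - 1"] q0 unfolding P_def by linarith
  \<comment> \<open>The angle of the midpoint of the labels \<open>s\<close>, ...,
    \<open>s + p - 1\<close>; rotating by it makes the nodes symmetric about 1.\<close>
  define \<phi> where "\<phi> = 2 * pi * (of_int s + (real p - 1) / 2) / real N"
  \<comment> \<open>\<open>u\<close> selects one column of \<open>A\<close>, which consists of
    \<open>p\<close> unimodular entries.\<close>
  define u :: "complex vec" where "u = unit_vec q 0"
  define v where "v = vec q (\<lambda>k. coeff P (\<pi> k) * cis (- \<phi>) ^ \<pi> k)"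
  have u: "u \<in> carrier_vec q" "u \<noteq> 0\<^sub>v q" and v_carrier: "v \<in> carrier_vec q"
    using q0 by (auto simp: u_def v_def)
  have "vnorm2 u = (\<Sum>i<q. if i = 0 then 1 else 0)"
    unfolding vnorm2_def by (rule sum.cong) (auto simp: u_def)
  then have norm_u: "vnorm2 u = 1" using q0 by simp
  have "(A *\<^sub>v u) $ i = A $$ (i, 0)" if "i < p" for i
    using A that q0 by (simp add: u_def)
  then have norm_Au: "vnorm2 (A *\<^sub>v u) = real p"
    using A by (simp add: vnorm2_def entries q0)
  have "(cmod ((A *\<^sub>v v) $ i))\<^sup>2 \<le> 1" if i: "i < p" for i
  proof -
    define \<theta> where "\<theta> = 2 * pi * of_int (s + int (\<rho> i)) / real N - \<phi>"
    have "\<rho> i < p" using \<rho> i by (auto simp: bij_betw_def)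
    \<comment> \<open>Even \<open>p - 1\<close> is a bound; the weaker \<open>p\<close> is the one
      that matches \<open>\<alpha>\<close>.\<close>
    then have \<rho>_bound: "\<bar>2 * real (\<rho> i) - (real p - 1)\<bar> \<le> real p" by linarith
    have "\<theta> / 2 = pi / (2 * real N) * (2 * real (\<rho> i) - (real p - 1))"
      using N by (simp add: \<theta>_def \<phi>_def field_simps)
    then have "\<bar>\<theta> / 2\<bar> = pi / (2 * real N) * \<bar>2 * real (\<rho> i) - (real p - 1)\<bar>"
      by (simp only: abs_mult) simp
    also have "\<dots> \<le> pi / (2 * real N) * real p"
      by (intro mult_left_mono \<rho>_bound) simp
    finally have \<theta>: "\<bar>\<theta> / 2\<bar> \<le> \<alpha>" by (simp add: \<alpha>_def)
    have "sin (\<theta> / 2) \<le> sin \<alpha>" "sin (- \<alpha>) \<le> sin (\<theta> / 2)"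
      using \<theta> \<alpha> by (subst sin_mono_le_eq; simp add: abs_le_iff)+
    then have "\<bar>sin (\<theta> / 2)\<bar> \<le> cos x"
      by (simp add: cos_x abs_le_iff)
    then have "cmod (poly P (cis \<theta>)) \<le> 1"
      unfolding P_def by (rule norm_arc_chebyshev_arc[OF cos_pos])
    then have "cmod ((A *\<^sub>v v) $ i) \<le> 1"
      using cis_mult_vec_eq_poly[OF A \<pi> entries[OF i] deg i, where \<phi> = \<phi>, folded v_def \<theta>_def]
      by (simp add: norm_mult)
    then show ?thesis by (simp add: power_le_one)
  qed
  then have norm_Av: "vnorm2 (A *\<^sub>v v) \<le> real p"
    using A sum_mono[of "{..<p}" "\<lambda>i. (cmod ((A *\<^sub>v v) $ i))\<^sup>2" "\<lambda>_. 1"] by (simp add: vnorm2_def)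
  have norm_v: "D\<^sup>2 \<le> vnorm2 v * real q"
  proof -
    \<comment> \<open>At -1 all powers are unimodular, so the value is at most the sum of the moduli
      of the coefficients; Cauchy-Schwarz turns this into \<open>vnorm2 v\<close> at the cost of a
      factor \<open>q\<close>.\<close>
    have "D \<le> cmod (poly P (- 1))"
      unfolding D_def P_def by (rule norm_arc_chebyshev_minus_1[OF x])
    also have "\<dots> \<le> (\<Sum>l<q. cmod (coeff P l))"
      unfolding poly_eq_sum_lessThan[OF deg]
      by (rule order.trans[OF norm_sum]) (simp add: norm_mult norm_power)
    finally have "D\<^sup>2 \<le> (\<Sum>l<q. cmod (coeff P l))\<^sup>2"
      by (intro power_mono) (simp_all add: D_def)
    also have "\<dots> \<le> (\<Sum>l<q. (cmod (coeff P l))\<^sup>2) * real q"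
      using sum_squared_le_sum_of_squares[of "\<lambda>l. cmod (coeff P l)" "{..<q}"] by simp
    also have "(\<Sum>l<q. (cmod (coeff P l))\<^sup>2) = (\<Sum>k<q. (cmod (coeff P (\<pi> k)))\<^sup>2)"
      by (rule sum.reindex_bij_betw[OF \<pi>, symmetric])
    also have "\<dots> = vnorm2 v"
      by (simp add: vnorm2_def v_def norm_mult norm_power)
    finally show ?thesis .
  qed
  have "1 \<le> D" by (simp add: D_def cosh_real_ge_1)
  have "v \<noteq> 0\<^sub>v q"
  proof
    assume "v = 0\<^sub>v q"
    then have "vnorm2 v = 0" by (simp add: vnorm2_def)
    with norm_v \<open>1 \<le> D\<close> show False by simp
  qed
  then have Av_pos: "0 < vnorm2 (A *\<^sub>v v)"
    using inj[OF v_carrier] A v_carrier by (intro vnorm2_pos[of _ p]) auto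
  have "D / sqrt (real q) = sqrt (D\<^sup>2 / real q)"
    using \<open>1 \<le> D\<close> by (simp add: real_sqrt_divide)
  also have "\<dots> \<le> sqrt (vnorm2 (A *\<^sub>v u) / vnorm2 u * (vnorm2 v / vnorm2 (A *\<^sub>v v)))"
  proof (rule real_sqrt_le_mono)
    have "D\<^sup>2 / real q \<le> vnorm2 v" using norm_v q0 by (simp add: field_simps)
    also have "\<dots> = real p * (vnorm2 v / real p)" using p0 by simp
    also have "\<dots> \<le> real p * (vnorm2 v / vnorm2 (A *\<^sub>v v))"
      using norm_Av Av_pos by (intro mult_left_mono divide_left_mono) auto
    finally show "D\<^sup>2 / real q \<le> vnorm2 (A *\<^sub>v u) / vnorm2 u * (vnorm2 v / vnorm2 (A *\<^sub>v v))"
      by (simp add: norm_u norm_Au)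
  qed
  also have "\<dots> \<le> condition_number A"
    by (rule condition_number_ge_rayleigh[OF A q0 q(2) inj u v_carrier \<open>v \<noteq> 0\<^sub>v q\<close>])
  finally show ?thesis by (simp add: D_def x_def)
qed

section \<open>From cosh to the Bessel function\<close>

lemma cosh_add_le:
  fixes x y :: real
  assumes "0 \<le> y"
  shows "cosh (x + y) \<le> cosh x * exp y"
proof -
  have "exp (- x) * exp (- y) \<le> exp (- x) * exp y"
    using assms by (intro mult_left_mono) auto
  then have "(exp x * exp y + exp (- x) * exp (- y)) / 2 \<le> (exp x * exp y + exp (- x) * exp y) / 2"
    by (intro divide_right_mono add_left_mono) simp_all
  then show ?thesis
    by (simp only: cosh_field_def minus_add_distrib exp_add distrib_right times_divide_eq_left)
qed

theorem theorem2:
  fixes N p q :: nat and A :: "complex mat"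
  assumes "1 \<le> q" and "q \<le> p" and "p < N"
    and "cyclically_contiguous_submatrix p q (dft_mat N) A"
  shows "condition_number A \<ge>
    (bessel_I0 (pi / 2 * (1 - real p / real N) * real q) - 1) /
    (2 * (sqrt (real N / real p) + 6 * real q))"
proof -
  define x where "x = pi / 2 * (1 - real p / real N)"
  define D where "D = cosh (real (q - 1) * x)"
  have x: "0 \<le> x" "x \<le> pi / 2"
    using assms(1-3) by (simp_all add: x_def field_simps)
  define y where "y = x * real q"
  have "bessel_I0 y \<le> cosh y"
    using x by (intro bessel_I0_le_cosh) (simp add: y_def)
  \<comment> \<open>The Chebyshev polynomial has degree \<open>q - 1\<close>, while the Bessel
    argument contains \<open>q\<close>; the difference costs a factor of at most
    \<open>exp x\<close>.\<close>
  also have "cosh y = cosh (real (q - 1) * x + x)"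
    using assms(1) by (simp add: y_def of_nat_diff algebra_simps)
  also have "\<dots> \<le> D * exp x"
    unfolding D_def by (rule cosh_add_le[OF x(1)])
  \<comment> \<open>As \<open>x \<le> pi / 2 < 2\<close>, the exponential is at most 9. The constant
    12 is taken to cancel the factor \<open>2 * 6\<close> of the denominator.\<close>
  also have "\<dots> \<le> D * 12"
  proof (rule mult_left_mono)
    have "exp x \<le> exp 2" using x(2) pi_less_4 by simp
    also have "exp 2 = (exp 1 :: real)\<^sup>2" by (simp flip: exp_of_nat_mult)
    also have "\<dots> \<le> 3\<^sup>2" by (intro power_mono exp_le) simp
    finally show "exp x \<le> 12" by simp
  qed (simp add: D_def)
  finally have num: "bessel_I0 y - 1 \<le> 12 * D" by simp
  have "(bessel_I0 y - 1) / (2 * (sqrt (real N / real p) + 6 * real q)) \<le> 12 * D / (12 * real q)"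
  \<comment> \<open>Dropping the square root from the denominator enlarges the fraction only when
    the numerator is nonnegative; otherwise the left side is at most 0.\<close>
  proof (cases "bessel_I0 y - 1 \<le> 0")
    case True
    have "(bessel_I0 y - 1) / (2 * (sqrt (real N / real p) + 6 * real q)) \<le> 0"
      using True by (intro divide_nonpos_nonneg) auto
    also have "0 \<le> 12 * D / (12 * real q)" by (simp add: D_def)
    finally show ?thesis .
  next
    case False
    then show ?thesis using num assms(1) by (intro frac_le) auto
  qed
  also have "\<dots> \<le> D / sqrt (real q)"
  proof -
    have "sqrt (real q) \<le> real q"
      using assms(1) by (intro real_le_lsqrt) (auto simp: power2_eq_square)
    then show ?thesis using assms(1) by (simp add: D_def divide_left_mono)
  qed
  also have "\<dots> \<le> condition_number A"
    unfolding D_def x_def by (rule condition_number_dft_submatrix_ge_cosh[OF assms])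
  finally show ?thesis by (simp add: y_def x_def)
qed

end
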